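(* Let $m,p,r,s\in \mathbb{N}$ and $j\in \mathbb{N}_0$, put $\nu = \min\{r,s\}$, and suppose that $2(\nu-1) \le p \le 2^r m$ and $2^s j \le 2^r m$. Then, with the convention $p_0=p$, $$K_p^{2^r m}(2^s j) = \sum_{\substack{0\le p_\nu \le \cdots \le p_1 \le p \\ p_\nu \equiv \cdots \equiv p_1\equiv p \pmod 2}} 2^{p_1 + \cdots + p_\nu} \left( \prod_{k=1}^{\nu} \binom{2^{r-k} m - p_k}{\frac{p_{k-1}-p_k}{2}} \right) K_{p_\nu}^{2^{f(s,r)}m}\big(2^{f(r,s)}j\big),$$ where the sum is over integers $p_1,\dots,p_\nu$, and where $f(a,b)=b-a$ if $a\le b$ and $f(a,b)=0$ if $a>b$.
   Context: $\mathbb{N}=\{1,2,\dots\}$, $\mathbb{N}_0=\{0,1,2,\dots\}$. For $x$ any number and $i\in\mathbb{N}_0$, $\binom{x}{i} = x(x-1)\cdots(x-i+1)/i!$ for $i\ge 1$ and $\binom{x}{0}=1$ (so the upper entry may be negative). The binary Krawtchouk polynomial of order $n$ and degree $p$ is $$K_p^n(x) = \sum_{i=0}^p (-1)^i \binom{x}{i}\binom{n-x}{p-i},$$ and the same formula is used to define $K_p^n(x)$ also when $p>n$ (for integers $0\le x\le n$ one then has $K_p^n(x)=0$). *)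

theory Defs
  imports Complex_Main "HOL-Library.FuncSet" "HOL-Number_Theory.Cong"
begin

definition krawtchouk :: "nat \<Rightarrow> nat \<Rightarrow> 'a::field_char_0 \<Rightarrow> 'a" where
  "krawtchouk n p x =
     (\<Sum>i=0..p. (-1) ^ i * (x gchoose i) * ((of_nat n - x) gchoose (p - i)))"

definition fdiff :: "nat \<Rightarrow> nat \<Rightarrow> nat" where
  "fdiff a b = (if a \<le> b then b - a else 0)"

(* A tuple (p_0, ..., p_\<nu>) with p_0 = p is an extensional function on {0..\<nu>};
   extensionality makes each tuple occur exactly once. *)
definition parity_chains :: "nat \<Rightarrow> nat \<Rightarrow> (nat \<Rightarrow> nat) set" where
  "parity_chains \<nu> p =
     {q \<in> {0..\<nu>} \<rightarrow>\<^sub>E {0..p}. q 0 = p \<and>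
        (\<forall>k\<in>{1..\<nu>}. q k \<le> q (k - 1) \<and> [q k = p] (mod 2))}"

end

theory Submission
  imports Defs "HOL-Computational_Algebra.Formal_Power_Series"
begin

unbundle fps_syntax

text \<open>
  \<open>K\<^sub>p\<^sup>n(x)\<close> is the coefficient of \<open>z\<^sup>p\<close> in \<open>(1 - z)\<^sup>x (1 + z)\<^bsup>n - x\<^esup>\<close>. Since
  \<open>(1 \<plusminus> z)\<^sup>2 = (1 + z\<^sup>2) (1 \<plusminus> w)\<close> for \<open>w = 2 z / (1 + z\<^sup>2)\<close>, the generating function for
  \<open>(2 N, 2 y)\<close> is \<open>(1 + z\<^sup>2)\<^sup>N\<close> times the one for \<open>(N, y)\<close> evaluated at \<open>w\<close>, which expresses
  \<open>K\<^sub>p\<^bsup>2N\<^esup>(2y)\<close> through the numbers \<open>K\<^sub>q\<^sup>N(y)\<close>. The theorem iterates this halving \<open>\<nu>\<close> times.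
\<close>

section \<open>Generating function of the Krawtchouk polynomials\<close>

lemma fps_const_sum: "fps_const (sum f A) = (\<Sum>i\<in>A. fps_const (f i))"
  by (simp add: fps_eq_iff fps_sum_nth)

text \<open>Binomial theorem for both factors, then a Cauchy product. The identity is polynomial in
  \<open>x\<close>, so any series may be inserted: \<open>fps_X\<close> to read off coefficients,
  and the rational series \<open>w\<close> in the halving step.\<close>

lemma krawtchouk_generating_function:
  fixes x :: "'a::field_char_0 fps"
  assumes "y \<le> n"
  shows "(1 - x) ^ y * (1 + x) ^ (n - y) =
    (\<Sum>q\<le>n. fps_const (krawtchouk n q (of_nat y)) * x ^ q)"
proof -
  define a where "a i = fps_const ((-1) ^ i * (of_nat (y choose i) :: 'a))" for i
  define b where "b i = fps_const (of_nat ((n - y) choose i) :: 'a)" for i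
  have "fps_const ((-1) ^ i) = (-1 :: 'a fps) ^ i" for i
    by (simp flip: fps_const_neg fps_const_power)
  then have "(1 - x) ^ y = (\<Sum>i\<le>y. a i * x ^ i)"
    using binomial_ring[of "- x" 1 y]
    by (simp add: a_def power_minus[of x] fps_of_nat mult_ac flip: fps_const_mult)
  moreover have "(1 + x) ^ (n - y) = (\<Sum>i\<le>n - y. b i * x ^ i)"
    using binomial_ring[of x 1 "n - y"] by (simp add: b_def fps_of_nat add.commute)
  \<comment> \<open>The Cauchy product runs over all \<open>i \<le> q\<close>; this is harmless
    because the binomials in \<open>a\<close> and \<open>b\<close> vanish beyond the degrees
    \<open>y\<close> and \<open>n - y\<close>.\<close>
  ultimately have "(1 - x) ^ y * (1 + x) ^ (n - y) =
      (\<Sum>q\<le>y + (n - y). (\<Sum>i\<le>q. a i * b (q - i)) * x ^ q)"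
    by (simp only: , intro polynomial_product) (simp_all add: a_def b_def)
  moreover have "(\<Sum>i\<le>q. a i * b (q - i)) = fps_const (krawtchouk n q (of_nat y))" for q
    using assms
    by (simp add: krawtchouk_def a_def b_def fps_const_sum atMost_atLeast0
        binomial_gbinomial[symmetric] flip: of_nat_diff)
  ultimately show ?thesis
    using assms by simp
qed

text \<open>Each summand vanishes: either \<open>i > y\<close>, or \<open>i \<le> y\<close> and then
  \<open>q - i > n - y\<close>. This allows the range of \<open>q\<close> to be changed freely above
  \<open>n\<close>.\<close>

lemma krawtchouk_eq_0:
  assumes "y \<le> n" "n < q"
  shows "krawtchouk n q (of_nat y) = 0"
proof -
  have "y choose i = 0 \<or> (n - y) choose (q - i) = 0" for i
    using assms by (cases "y < i") (auto intro: binomial_eq_0)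
  then have "(-1) ^ i * (of_nat y gchoose i) * ((of_nat n - of_nat y) gchoose (q - i)) = (0::'a)" for i
    using assms(1) by (metis binomial_gbinomial mult_eq_0_iff of_nat_0 of_nat_diff)
  then show ?thesis
    unfolding krawtchouk_def by (intro sum.neutral) blast
qed

lemma fps_one_plus_X2_power_nth:
  "((1 + fps_X\<^sup>2) ^ n :: 'a::field_char_0 fps) $ k =
    (if even k then of_nat (n choose (k div 2)) else 0)"
proof -
  have "((1 + fps_X\<^sup>2) ^ n :: 'a fps) = (\<Sum>i\<le>n. of_nat (n choose i) * fps_X ^ (2 * i))"
    using binomial_ring[of "fps_X\<^sup>2 :: 'a fps" 1 n] by (simp add: add.commute power_mult)
  then have "((1 + fps_X\<^sup>2) ^ n :: 'a fps) $ k =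
      (\<Sum>i\<le>n. if k = 2 * i then of_nat (n choose i) else 0)"
    by (simp add: fps_sum_nth fps_mult_of_nat_nth fps_X_power_nth if_distrib cong: if_cong)
  also have "\<dots> = (if even k then of_nat (n choose (k div 2)) else 0)"
  proof (cases "even k")
    case True
    then obtain l where k: "k = 2 * l" by blast
    then have "(\<Sum>i\<le>n. if k = 2 * i then of_nat (n choose i) else 0) =
        (\<Sum>i\<le>n. if l = i then of_nat (n choose i) else (0::'a))"
      by (intro sum.cong) auto
    \<comment> \<open>If \<open>l > n\<close>, no index of the sum matches, and the binomial on the
      right is zero as well.\<close>
    then show ?thesis using k by (simp add: binomial_eq_0)
  next
    case False
    then show ?thesis by (auto intro!: sum.neutral)
  qed
  finally show ?thesis .
qed

lemma krawtchouk_eq_fps_nth: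
  assumes "y \<le> n"
  shows "krawtchouk n p (of_nat y :: 'a::field_char_0) =
    ((1 - fps_X) ^ y * (1 + fps_X) ^ (n - y)) $ p"
  using assms
  by (subst krawtchouk_generating_function)
     (auto simp: fps_sum_nth fps_X_power_nth if_distrib krawtchouk_eq_0 cong: if_cong)

section \<open>Halving the order and the argument\<close>

lemma krawtchouk_double:
  fixes n p y :: nat
  assumes "y \<le> n"
  shows "krawtchouk (2 * n) p (2 * of_nat y :: 'a::field_char_0) =
    (\<Sum>q | q \<le> p \<and> [q = p] (mod 2).
       2 ^ q * ((of_nat n - of_nat q) gchoose ((p - q) div 2)) * krawtchouk n q (of_nat y))"
proof -
  let ?K = "\<lambda>q. krawtchouk n q (of_nat y :: 'a)"
  define D :: "'a fps" where "D = 1 + fps_X\<^sup>2"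
  define w where "w = 2 * fps_X * inverse D"
  have Dinv: "D * inverse D = 1"
    unfolding D_def by (rule inverse_mult_eq_1') simp
  have Dw: "D * w = 2 * fps_X"
    unfolding w_def using Dinv by (simp add: algebra_simps)
  \<comment> \<open>Since \<open>D * w = 2 * fps_X\<close>, the left sides are
    \<open>D - 2 * fps_X\<close> and \<open>D + 2 * fps_X\<close>.\<close>
  have sq: "D * (1 - w) = (1 - fps_X)\<^sup>2" "D * (1 + w) = (1 + fps_X)\<^sup>2"
    by (simp_all add: right_diff_distrib distrib_left Dw)
       (simp_all add: D_def power2_eq_square algebra_simps)
  have Dn: "D ^ n = D ^ y * D ^ (n - y)"
    using assms by (simp flip: power_add)
  have "(1 - fps_X) ^ (2 * y) * (1 + fps_X) ^ (2 * n - 2 * y) =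
      (D * (1 - w)) ^ y * (D * (1 + w)) ^ (n - y)"
    by (simp add: sq flip: power_mult diff_mult_distrib2)
  also have "\<dots> = D ^ n * ((1 - w) ^ y * (1 + w) ^ (n - y))"
    by (simp add: Dn power_mult_distrib mult_ac)
  also have "\<dots> = (\<Sum>q\<le>n. D ^ n * (fps_const (?K q) * w ^ q))"
    by (subst krawtchouk_generating_function[OF assms])
       (simp_all add: sum_distrib_left)
  \<comment> \<open>As \<open>q \<le> n\<close>, the factor \<open>D ^ n\<close> clears the
    denominator of \<open>w ^ q\<close>: \<open>q\<close> copies of \<open>D\<close> turn it into
    \<open>(2 * fps_X) ^ q\<close>, and \<open>D ^ (n - q)\<close> remains.\<close>
  also have "\<dots> = (\<Sum>q\<le>n. fps_const (2 ^ q * ?K q) * (fps_X ^ q * D ^ (n - q)))"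
  proof (rule sum.cong)
    fix q assume "q \<in> {..n}"
    then have "D ^ n * w ^ q = D ^ (n - q) * (D * w) ^ q"
      by (simp add: power_mult_distrib flip: power_add mult.assoc)
    also have "\<dots> = fps_const (2 ^ q) * (fps_X ^ q * D ^ (n - q))"
      by (simp add: Dw power_mult_distrib mult_ac numeral_fps_const flip: fps_const_power)
    finally show "D ^ n * (fps_const (?K q) * w ^ q) =
        fps_const (2 ^ q * ?K q) * (fps_X ^ q * D ^ (n - q))"
      by (simp add: mult_ac flip: fps_const_mult)
  qed simp
  finally have gf: "(1 - fps_X) ^ (2 * y) * (1 + fps_X) ^ (2 * n - 2 * y) =
      (\<Sum>q\<le>n. fps_const (2 ^ q * ?K q) * (fps_X ^ q * D ^ (n - q)))" .
  let ?t = "\<lambda>q. 2 ^ q * ((of_nat n - of_nat q) gchoose ((p - q) div 2)) * ?K q"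
  have "krawtchouk (2 * n) p (2 * of_nat y :: 'a) =
      (\<Sum>q\<le>n. 2 ^ q * ?K q * (fps_X ^ q * D ^ (n - q)) $ p)"
    using krawtchouk_eq_fps_nth[of "2 * y" "2 * n" p, where ?'a = 'a] assms
    by (simp add: gf fps_sum_nth)
  \<comment> \<open>\<open>D ^ (n - q)\<close> has only even powers, which forces \<open>q\<close>
    to have the parity of \<open>p\<close>.\<close>
  also have "\<dots> = (\<Sum>q\<le>n. if q \<le> p \<and> [q = p] (mod 2) then ?t q else 0)"
  proof (rule sum.cong)
    fix q assume "q \<in> {..n}"
    moreover have "[q = p] (mod 2) \<longleftrightarrow> even (p - q)" if "q \<le> p"
      using that by (metis cong_def cong_sym_eq mod_eq_dvd_iff_nat)
    ultimately show "2 ^ q * ?K q * (fps_X ^ q * D ^ (n - q)) $ p =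
        (if q \<le> p \<and> [q = p] (mod 2) then ?t q else 0)"
      by (auto simp: fps_X_power_mult_nth D_def fps_one_plus_X2_power_nth binomial_gbinomial)
  qed simp
  also have "\<dots> = (\<Sum>q \<in> {q. q \<le> p \<and> [q = p] (mod 2)} \<inter> {..n}. ?t q)"
    by (simp add: sum.If_cases Int_commute)
  \<comment> \<open>For \<open>n < q \<le> p\<close> the generalized binomial has a negative upper
    entry and need not vanish; the Krawtchouk factor does.\<close>
  also have "\<dots> = (\<Sum>q | q \<le> p \<and> [q = p] (mod 2). ?t q)"
  proof (intro sum.mono_neutral_left ballI)
    fix q assume "q \<in> {q. q \<le> p \<and> [q = p] (mod 2)} - {q. q \<le> p \<and> [q = p] (mod 2)} \<inter> {..n}"
    then show "?t q = 0"
      using krawtchouk_eq_0[OF assms, of q] by auto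
  qed auto
  finally show ?thesis .
qed

section \<open>Sums over chains of equal parity\<close>

lemma finite_parity_chains [simp]: "finite (parity_chains \<nu> p)"
  by (rule finite_subset[of _ "{0..\<nu>} \<rightarrow>\<^sub>E {0..p}"]) (auto simp: parity_chains_def intro: finite_PiE)

lemma parity_chains_0: "parity_chains 0 p = {\<lambda>k\<in>{0}. p}"
  by (fastforce simp: parity_chains_def PiE_iff extensional_def restrict_def)

lemma parity_chains_last:
  assumes "q \<in> parity_chains \<nu> p"
  shows "q \<nu> \<le> p" "[q \<nu> = p] (mod 2)"
  using assms by (cases \<nu>; force simp: parity_chains_def PiE_iff)+

text \<open>A longer chain is a shorter one with a last entry \<open>u\<close> appended. By
  transitivity, congruence to \<open>p\<close> becomes congruence to \<open>q \<nu>\<close>, so the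
  inner sum has the index set of \<open>krawtchouk_double\<close> at degree
  \<open>q \<nu>\<close>.\<close>

lemma sum_parity_chains_Suc:
  "(\<Sum>q\<in>parity_chains (Suc \<nu>) p. g q) =
    (\<Sum>q\<in>parity_chains \<nu> p. \<Sum>u | u \<le> q \<nu> \<and> [u = q \<nu>] (mod 2). g (q(Suc \<nu> := u)))"
proof -
  let ?S = "SIGMA q:parity_chains \<nu> p. {u. u \<le> q \<nu> \<and> [u = q \<nu>] (mod 2)}"
  have "(\<Sum>q\<in>parity_chains (Suc \<nu>) p. g q) = (\<Sum>(q, u)\<in>?S. g (q(Suc \<nu> := u)))"
  \<comment> \<open>Restricting to \<open>{0..\<nu>}\<close> makes the shortened chain extensional
    again; the update at \<open>Suc \<nu>\<close> undoes it.\<close>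
  proof (rule sum.reindex_bij_witness[where
        i = "\<lambda>(q, u). q(Suc \<nu> := u)" and j = "\<lambda>q. (restrict q {0..\<nu>}, q (Suc \<nu>))"])
    fix q assume q: "q \<in> parity_chains (Suc \<nu>) p"
    have restr: "restrict q {0..\<nu>} \<in> parity_chains \<nu> p"
      using q by (auto simp: parity_chains_def PiE_iff)
    have "\<forall>k\<in>{1..Suc \<nu>}. q k \<le> q (k - 1) \<and> [q k = p] (mod 2)"
      using q by (simp add: parity_chains_def)
    then have "q (Suc \<nu>) \<le> q \<nu> \<and> [q (Suc \<nu>) = p] (mod 2)"
      by (auto dest: bspec[of _ _ "Suc \<nu>"])
    with parity_chains_last[OF restr]
    show "(restrict q {0..\<nu>}, q (Suc \<nu>)) \<in> ?S"
      using restr by (auto intro: cong_trans cong_sym)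
    show eq: "(case (restrict q {0..\<nu>}, q (Suc \<nu>)) of (q, u) \<Rightarrow> q(Suc \<nu> := u)) = q"
      using q by (auto simp: parity_chains_def PiE_iff extensional_def fun_eq_iff)
    show "(case (restrict q {0..\<nu>}, q (Suc \<nu>)) of (q, u) \<Rightarrow> g (q(Suc \<nu> := u))) = g q"
      using eq by simp
  next
    fix qu assume "qu \<in> ?S"
    then obtain q u where qu: "qu = (q, u)" and q: "q \<in> parity_chains \<nu> p"
      and u: "u \<le> q \<nu>" "[u = q \<nu>] (mod 2)"
      by auto
    show "(restrict (case qu of (q, u) \<Rightarrow> q(Suc \<nu> := u)) {0..\<nu>},
        (case qu of (q, u) \<Rightarrow> q(Suc \<nu> := u)) (Suc \<nu>)) = qu"
      using q by (auto simp: qu parity_chains_def PiE_iff extensional_def fun_eq_iff restrict_def)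
    have "u \<le> p" "[u = p] (mod 2)"
      using parity_chains_last[OF q] u by (auto intro: cong_trans)
    then show "(case qu of (q, u) \<Rightarrow> q(Suc \<nu> := u)) \<in> parity_chains (Suc \<nu>) p"
      using q u by (auto simp: qu parity_chains_def PiE_iff extensional_def le_Suc_eq)
  qed
  then show ?thesis
    by (simp add: sum.Sigma)
qed

section \<open>Iterating the halving\<close>

lemma krawtchouk_iterated_double:
  fixes n p y \<nu> :: nat
  assumes "y \<le> n"
  shows "krawtchouk (2 ^ \<nu> * n) p (2 ^ \<nu> * of_nat y :: 'a::field_char_0) =
    (\<Sum>q\<in>parity_chains \<nu> p.
       2 ^ (\<Sum>k=1..\<nu>. q k)
       * (\<Prod>k=1..\<nu>. (2 ^ (\<nu> - k) * of_nat n - of_nat (q k)) gchoose ((q (k - 1) - q k) div 2))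
       * krawtchouk n (q \<nu>) (of_nat y))"
  using assms
\<comment> \<open>The hypothesis is used at \<open>2 * n\<close> and \<open>2 * y\<close>, so the
  additional halving acts on the innermost Krawtchouk factor and appends to the end of the
  chain.\<close>
proof (induction \<nu> arbitrary: n y)
  case 0
  then show ?case by (simp add: parity_chains_0)
next
  case (Suc \<nu>)
  let ?c = "\<lambda>q k. (2 ^ (Suc \<nu> - k) * of_nat n - of_nat (q k)) gchoose ((q (k - 1) - q k) div 2) :: 'a"
  \<comment> \<open>For \<open>k \<le> \<nu>\<close> the doubled order is absorbed into the power of
    two.\<close>
  have c: "(\<Prod>k=1..\<nu>. (2 ^ (\<nu> - k) * (2 * of_nat n) - of_nat (q k))
      gchoose ((q (k - 1) - q k) div 2)) = (\<Prod>k=1..\<nu>. ?c q k)" for q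
    by (intro prod.cong) (auto simp: Suc_diff_le mult_ac)
  have upd: "(\<Sum>k=1..\<nu>. (q(Suc \<nu> := u)) k) = (\<Sum>k=1..\<nu>. q k)"
    "(\<Prod>k=1..\<nu>. ?c (q(Suc \<nu> := u)) k) = (\<Prod>k=1..\<nu>. ?c q k)" for q u
    by (auto intro!: sum.cong prod.cong)
  have "krawtchouk (2 ^ Suc \<nu> * n) p (2 ^ Suc \<nu> * of_nat y :: 'a) =
      krawtchouk (2 ^ \<nu> * (2 * n)) p (2 ^ \<nu> * of_nat (2 * y))"
    by (simp add: mult_ac)
  also have "\<dots> = (\<Sum>q\<in>parity_chains \<nu> p. 2 ^ (\<Sum>k=1..\<nu>. q k) * (\<Prod>k=1..\<nu>. ?c q k)
        * krawtchouk (2 * n) (q \<nu>) (2 * of_nat y))"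
    using Suc.IH[of "2 * y" "2 * n"] Suc.prems
    by (simp only: c of_nat_mult of_nat_numeral mult_le_mono2)
  also have "\<dots> = (\<Sum>q\<in>parity_chains \<nu> p. \<Sum>u | u \<le> q \<nu> \<and> [u = q \<nu>] (mod 2).
      2 ^ (\<Sum>k=1..Suc \<nu>. (q(Suc \<nu> := u)) k) * (\<Prod>k=1..Suc \<nu>. ?c (q(Suc \<nu> := u)) k)
        * krawtchouk n ((q(Suc \<nu> := u)) (Suc \<nu>)) (of_nat y))"
    unfolding krawtchouk_double[OF Suc.prems] sum_distrib_left
  proof (intro sum.cong refl)
    fix q :: "nat \<Rightarrow> nat" and u
    have s: "(\<Sum>k=1..Suc \<nu>. (q(Suc \<nu> := u)) k) = (\<Sum>k=1..\<nu>. q k) + u"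
      using upd(1)[of q u] by simp
    \<comment> \<open>In the new factor \<open>k = Suc \<nu>\<close>, the power of two is
      \<open>2 ^ 0\<close> and the preceding entry is still \<open>q \<nu>\<close>.\<close>
    have t: "(\<Prod>k=1..Suc \<nu>. ?c (q(Suc \<nu> := u)) k) =
        (\<Prod>k=1..\<nu>. ?c q k) * ((of_nat n - of_nat u) gchoose ((q \<nu> - u) div 2))"
      using upd(2)[of q u] by simp
    show "2 ^ (\<Sum>k=1..\<nu>. q k) * (\<Prod>k=1..\<nu>. ?c q k)
        * (2 ^ u * ((of_nat n - of_nat u) gchoose ((q \<nu> - u) div 2)) * krawtchouk n u (of_nat y)) =
      2 ^ (\<Sum>k=1..Suc \<nu>. (q(Suc \<nu> := u)) k) * (\<Prod>k=1..Suc \<nu>. ?c (q(Suc \<nu> := u)) k)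
        * krawtchouk n ((q(Suc \<nu> := u)) (Suc \<nu>)) (of_nat y)"
      unfolding s t by (simp add: power_add mult_ac)
  qed
  also have "\<dots> = (\<Sum>q\<in>parity_chains (Suc \<nu>) p.
      2 ^ (\<Sum>k=1..Suc \<nu>. q k) * (\<Prod>k=1..Suc \<nu>. ?c q k) * krawtchouk n (q (Suc \<nu>)) (of_nat y))"
    by (rule sum_parity_chains_Suc[symmetric])
  finally show ?case .
qed

theorem theorem3p1:
  fixes m p r s j \<nu> :: nat
  assumes "m \<ge> 1" and "p \<ge> 1" and "r \<ge> 1" and "s \<ge> 1"
    and "\<nu> = min r s"
    and "2 * (\<nu> - 1) \<le> p" and "p \<le> 2 ^ r * m"
    and "2 ^ s * j \<le> 2 ^ r * m"
  shows "krawtchouk (2 ^ r * m) p (2 ^ s * real j) =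
    (\<Sum>q\<in>parity_chains \<nu> p.
       2 ^ (\<Sum>k=1..\<nu>. q k)
       * (\<Prod>k=1..\<nu>. (2 ^ (r - k) * real m - real (q k)) gchoose ((q (k - 1) - q k) div 2))
       * krawtchouk (2 ^ fdiff s r * m) (q \<nu>) (2 ^ fdiff r s * real j))"
proof -
  \<comment> \<open>Order and argument left after \<open>\<nu>\<close> halvings; as
    \<open>\<nu>\<close> is the minimum, at least one of the remaining exponents is zero.\<close>
  define n where "n = 2 ^ (r - \<nu>) * m"
  define y where "y = 2 ^ (s - \<nu>) * j"
  have le: "\<nu> \<le> r" "\<nu> \<le> s"
    using assms(5) by auto
  then have ny: "2 ^ \<nu> * n = 2 ^ r * m" "2 ^ \<nu> * y = 2 ^ s * j" "2 ^ \<nu> * real y = 2 ^ s * real j"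
    by (simp_all add: n_def y_def flip: power_add mult.assoc)
  have "y \<le> n"
    using assms(8) by (simp flip: ny(1,2))
  moreover have "(\<Prod>k=1..\<nu>. (2 ^ (\<nu> - k) * real n - real (q k)) gchoose ((q (k - 1) - q k) div 2)) =
      (\<Prod>k=1..\<nu>. (2 ^ (r - k) * real m - real (q k)) gchoose ((q (k - 1) - q k) div 2))" for q
  proof (rule prod.cong)
    fix k assume "k \<in> {1..\<nu>}"
    then have "2 ^ (\<nu> - k) * real n = 2 ^ (r - k) * real m"
      using le by (simp add: n_def flip: power_add mult.assoc)
    then show "(2 ^ (\<nu> - k) * real n - real (q k)) gchoose ((q (k - 1) - q k) div 2) =
        (2 ^ (r - k) * real m - real (q k)) gchoose ((q (k - 1) - q k) div 2)"
      by simp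
  qed simp
  \<comment> \<open>The truncated differences are \<open>fdiff s r = r - \<nu>\<close> and
    \<open>fdiff r s = s - \<nu>\<close>.\<close>
  moreover have "2 ^ fdiff s r * m = n" "2 ^ fdiff r s * real j = real y"
    using assms(5) by (auto simp: fdiff_def n_def y_def)
  ultimately show ?thesis
    using krawtchouk_iterated_double[of y n \<nu> p, where ?'a = real] by (simp only: ny)
qed

end
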